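(* Let $\mathcal{H}$ be a complex Hilbert space with scalar product $\langle\cdot,\cdot\rangle$ and norm $\|\cdot\|$. Let $A:\mathcal{D}\subset\mathcal{H}\to\mathcal{H}$ be a self-adjoint operator defined on a dense domain $\mathcal{D}$, which is semibounded below and has a discrete spectrum $\lambda_1\le\lambda_2\le\lambda_3\le\cdots$. Let $\{B_p:A(\mathcal{D})\to\mathcal{H}\}_{p=1}^n$ be a collection of symmetric operators leaving $\mathcal{D}$ invariant. Let $\{u_i\}_{i=1}^\infty$ be a basis of orthonormal eigenvectors of $A$, with $u_i$ corresponding to $\lambda_i$. If $k\ge1$ is such that $\lambda_{k+1}>\lambda_k$, then for every couple $(f,g)\in\Im_{\lambda_{k+1}}$, $$\bigg[\sum_{i=1}^k\sum_{p=1}^n f(\lambda_i)\langle[A,B_p]u_i,B_pu_i\rangle\bigg]^2\le\bigg[\sum_{i=1}^k\sum_{p=1}^n g(\lambda_i)\langle[A,B_p]u_i,B_pu_i\rangle\bigg]\bigg[\sum_{i=1}^k\sum_{p=1}^n\frac{(f(\lambda_i))^2}{g(\lambda_i)(\lambda_{k+1}-\lambda_i)}\|[A,B_p]u_i\|^2\bigg].$$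
   Context: For operators $S,T$, the commutator is $[S,T]=ST-TS$. Eigenvalues are listed with multiplicity. The operators $B_p$ are understood to be defined on $\mathcal{D}$ as well as on $A(\mathcal{D})$, with $B_p(\mathcal{D})\subset\mathcal{D}$, so that $[A,B_p]$ makes sense on $\mathcal{D}$; symmetric means $\langle B_pv,w\rangle=\langle v,B_pw\rangle$ for all $v,w$ in the domain of $B_p$. Definition of $\Im_\lambda$: for $\lambda>0$, a couple $(f,g)$ of functions defined on the open interval $]0,\lambda[$ belongs to $\Im_\lambda$ if (1) $f$ and $g$ are positive, and (2) for all $x,y\in]0,\lambda[$ with $x\neq y$, $$\Big(\frac{f(x)-f(y)}{x-y}\Big)^2+\Big(\frac{(f(x))^2}{g(x)(\lambda-x)}+\frac{(f(y))^2}{g(y)(\lambda-y)}\Big)\Big(\frac{g(x)-g(y)}{x-y}\Big)\le0.$$ In this definition $f$ and $g$ may be defined only on a discrete set of eigenvalues: for the claim it is enough that $f,g$ be defined on $\{\lambda_1,\dots,\lambda_k\}$ and satisfy (1) and (2) there with $\lambda=\lambda_{k+1}$. *)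

theory Defs
  imports "HOL-Analysis.Analysis" "HOL-Library.Complex_Order"
begin

section \<open>Complex Hilbert spaces\<close>

class complex_vector = real_vector +
  fixes scaleC :: "complex \<Rightarrow> 'a \<Rightarrow> 'a"  (infixr "*\<^sub>C" 75)
  assumes scaleC_add_right: "a *\<^sub>C (x + y) = a *\<^sub>C x + a *\<^sub>C y"
    and scaleC_add_left: "(a + b) *\<^sub>C x = a *\<^sub>C x + b *\<^sub>C x"
    and scaleC_scaleC: "a *\<^sub>C b *\<^sub>C x = (a * b) *\<^sub>C x"
    and scaleC_of_real: "complex_of_real r *\<^sub>C x = r *\<^sub>R x"

global_interpretation complex_vector:
  vector_space "scaleC :: complex \<Rightarrow> 'a \<Rightarrow> 'a :: complex_vector"
  defines csubspace = complex_vector.subspace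
    and cspan = complex_vector.span
    and cdependent = complex_vector.dependent
    and crepresentation = complex_vector.representation
    and cextend_basis = complex_vector.extend_basis
    and cdim = complex_vector.dim
proof unfold_locales
  show "1 *\<^sub>C x = x" for x :: 'a
    using scaleC_of_real[of 1 x] by simp
qed (auto simp: scaleC_add_right scaleC_add_left scaleC_scaleC)

text \<open>
  The scalar product is linear in its first argument. The norm is the one of the underlying
  Banach space, tied to the scalar product by \<open>cinner_self\<close>, which also gives
  positive definiteness.
\<close>

class chilbert_space = complex_vector + banach +
  fixes cinner :: "'a \<Rightarrow> 'a \<Rightarrow> complex"
  assumes cinner_commute: "cinner x y = cnj (cinner y x)"
    and cinner_add_left: "cinner (x + y) z = cinner x z + cinner y z"
    and cinner_scaleC_left: "cinner (c *\<^sub>C x) y = c * cinner x y"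
    and cinner_self: "cinner x x = complex_of_real ((norm x)\<^sup>2)"

instantiation complex :: chilbert_space
begin

definition "scaleC (c :: complex) (x :: complex) = c * x"
definition "cinner (x :: complex) (y :: complex) = x * cnj y"

instance
proof
  fix x :: complex
  show "cinner x x = complex_of_real ((norm x)\<^sup>2)"
    by (simp add: cinner_complex_def complex_norm_square[symmetric])
qed (auto simp: scaleC_complex_def cinner_complex_def algebra_simps scaleR_conv_of_real)

end

definition orthonormal_basis :: "nat set \<Rightarrow> (nat \<Rightarrow> 'a::chilbert_space) \<Rightarrow> bool" where
  "orthonormal_basis I u \<longleftrightarrow>
     (\<forall>i\<in>I. \<forall>j\<in>I. cinner (u i) (u j) = (if i = j then 1 else 0)) \<and>
     closure (cspan (u ` I)) = UNIV"

section \<open>Unbounded operators\<close>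

text \<open>
  An operator with domain \<open>D\<close> is represented by the set \<open>D\<close> and a total function whose values
  outside \<open>D\<close> carry no meaning.
\<close>

definition linear_operator :: "'a::chilbert_space set \<Rightarrow> ('a \<Rightarrow> 'a) \<Rightarrow> bool" where
  "linear_operator D T \<longleftrightarrow> csubspace D \<and>
     (\<forall>v\<in>D. \<forall>w\<in>D. T (v + w) = T v + T w) \<and> (\<forall>c. \<forall>v\<in>D. T (c *\<^sub>C v) = c *\<^sub>C T v)"

definition symmetric_operator :: "'a::chilbert_space set \<Rightarrow> ('a \<Rightarrow> 'a) \<Rightarrow> bool" where
  "symmetric_operator D T \<longleftrightarrow> linear_operator D T \<and>
     (\<forall>v\<in>D. \<forall>w\<in>D. cinner (T v) w = cinner v (T w))"

definition adjoint_domain :: "'a::chilbert_space set \<Rightarrow> ('a \<Rightarrow> 'a) \<Rightarrow> 'a set" where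
  "adjoint_domain D T = {w. \<exists>z. \<forall>v\<in>D. cinner (T v) w = cinner v z}"

text \<open>The element chosen below is unique when \<open>D\<close> is dense.\<close>

definition adjoint_operator :: "'a::chilbert_space set \<Rightarrow> ('a \<Rightarrow> 'a) \<Rightarrow> 'a \<Rightarrow> 'a" where
  "adjoint_operator D T w = (THE z. \<forall>v\<in>D. cinner (T v) w = cinner v z)"

definition self_adjoint :: "'a::chilbert_space set \<Rightarrow> ('a \<Rightarrow> 'a) \<Rightarrow> bool" where
  "self_adjoint D T \<longleftrightarrow> linear_operator D T \<and> closure D = UNIV \<and>
     adjoint_domain D T = D \<and> (\<forall>w\<in>D. adjoint_operator D T w = T w)"

definition semibounded_below :: "'a::chilbert_space set \<Rightarrow> ('a \<Rightarrow> 'a) \<Rightarrow> bool" where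
  "semibounded_below D T \<longleftrightarrow> (\<exists>c::real. \<forall>v\<in>D. c * (norm v)\<^sup>2 \<le> Re (cinner (T v) v))"

definition resolvent_set :: "'a::chilbert_space set \<Rightarrow> ('a \<Rightarrow> 'a) \<Rightarrow> complex set" where
  "resolvent_set D T = {z. bij_betw (\<lambda>v. T v - z *\<^sub>C v) D UNIV \<and>
     (\<exists>K. \<forall>v\<in>D. norm v \<le> K * norm (T v - z *\<^sub>C v))}"

definition spectrum :: "'a::chilbert_space set \<Rightarrow> ('a \<Rightarrow> 'a) \<Rightarrow> complex set" where
  "spectrum D T = - resolvent_set D T"

definition eigenspace :: "'a::chilbert_space set \<Rightarrow> ('a \<Rightarrow> 'a) \<Rightarrow> complex \<Rightarrow> 'a set" where
  "eigenspace D T z = {v \<in> D. T v = z *\<^sub>C v}"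

text \<open>The spectrum consists of isolated eigenvalues of finite multiplicity.\<close>

definition discrete_spectrum :: "'a::chilbert_space set \<Rightarrow> ('a \<Rightarrow> 'a) \<Rightarrow> bool" where
  "discrete_spectrum D T \<longleftrightarrow> discrete (spectrum D T) \<and>
     (\<forall>z\<in>spectrum D T. eigenspace D T z \<noteq> {0} \<and>
        (\<exists>F. finite F \<and> eigenspace D T z \<subseteq> cspan F))"

text \<open>
  \<open>ev 1 \<le> ev 2 \<le> \<dots>\<close> lists the spectrum with multiplicity; \<open>ev 0\<close> carries no meaning.
\<close>

definition lists_spectrum :: "'a::chilbert_space set \<Rightarrow> ('a \<Rightarrow> 'a) \<Rightarrow> (nat \<Rightarrow> real) \<Rightarrow> bool" where
  "lists_spectrum D T ev \<longleftrightarrow>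
     (\<forall>i\<ge>1. ev i \<le> ev (Suc i)) \<and>
     spectrum D T = complex_of_real ` ev ` {1..} \<and>
     (\<forall>i\<ge>1. finite {j. 1 \<le> j \<and> ev j = ev i} \<and>
        card {j. 1 \<le> j \<and> ev j = ev i} = cdim (eigenspace D T (complex_of_real (ev i))))"

definition commutator :: "('a \<Rightarrow> 'a) \<Rightarrow> ('a \<Rightarrow> 'a) \<Rightarrow> 'a \<Rightarrow> 'a::chilbert_space" where
  "commutator S T v = S (T v) - T (S v)"

section \<open>Admissible couples of functions\<close>

text \<open>
  \<open>Im_couples S l\<close> is the class $\Im_l$ for functions defined on \<open>S\<close>: the case
  \<open>S = {0<..<l}\<close> is the original class, and a finite set \<open>S\<close> of eigenvalues below \<open>l\<close> gives
  its discrete variant. Values of the functions outside \<open>S\<close> are irrelevant.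
\<close>

definition Im_couples :: "real set \<Rightarrow> real \<Rightarrow> ((real \<Rightarrow> real) \<times> (real \<Rightarrow> real)) set" where
  "Im_couples S l = {(f, g).
     (\<forall>x\<in>S. 0 < f x \<and> 0 < g x) \<and>
     (\<forall>x\<in>S. \<forall>y\<in>S. x \<noteq> y \<longrightarrow>
        ((f x - f y) / (x - y))\<^sup>2 +
        ((f x)\<^sup>2 / (g x * (l - x)) + (f y)\<^sup>2 / (g y * (l - y))) * ((g x - g y) / (x - y)) \<le> 0)}"

end

(* Let v = B_p u_i and b_ij = <B_p u_i, u_j>. Since <[A,B_p] u_i, u_j> = (lambda_j - lambda_i) b_ij,
   Parseval's identity turns the three sums into sums over i <= k and all j of |b_ij|^2 times
   f_i (lambda_j - lambda_i), g_i (lambda_j - lambda_i) and h_i (lambda_j - lambda_i)^2, where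
   h_i = f_i^2 / (g_i (lambda_(k+1) - lambda_i)). As |b_ij| = |b_ji|, the part with j <= k may be
   symmetrised in i and j. After that the three summands x, y, z satisfy x^2 <= y z with y, z >= 0
   for every pair (i, j): for j <= k this is condition (2), and for j > k it is
   lambda_(k+1) <= lambda_j. The Cauchy-Schwarz inequality concludes. *)
theory Submission
  imports Defs
begin

section \<open>Orthonormal expansions\<close>

lemma cinner_add_right: "cinner x (y + z) = cinner x y + cinner x (z :: 'a::chilbert_space)"
  by (metis cinner_commute cinner_add_left complex_cnj_add)

lemma cinner_scaleC_right: "cinner x (c *\<^sub>C y) = cnj c * cinner x (y :: 'a::chilbert_space)"
  by (metis cinner_commute cinner_scaleC_left complex_cnj_mult)

lemma cinner_diff_left: "cinner (x - y) z = cinner x z - cinner y (z :: 'a::chilbert_space)"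
  using cinner_add_left[of "x - y" y z] by simp

lemma cinner_diff_right: "cinner z (x - y) = cinner z x - cinner z (y :: 'a::chilbert_space)"
  using cinner_add_right[of z "x - y" y] by simp

lemma cinner_zero_left [simp]: "cinner 0 (z :: 'a::chilbert_space) = 0"
  using cinner_add_left[of 0 0 z] by simp

lemma cinner_zero_right [simp]: "cinner (z :: 'a::chilbert_space) 0 = 0"
  using cinner_add_right[of z 0 0] by simp

lemma cinner_sum_left: "cinner (\<Sum>i\<in>F. x i) y = (\<Sum>i\<in>F. cinner (x i) (y :: 'a::chilbert_space))"
  by (induction F rule: infinite_finite_induct) (auto simp: cinner_add_left)

lemma cinner_sum_right: "cinner y (\<Sum>i\<in>F. x i) = (\<Sum>i\<in>F. cinner (y :: 'a::chilbert_space) (x i))"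
  by (induction F rule: infinite_finite_induct) (auto simp: cinner_add_right)

lemma norm_add_orthogonal:
  fixes x y :: "'a::chilbert_space"
  assumes "cinner x y = 0"
  shows "(norm (x + y))\<^sup>2 = (norm x)\<^sup>2 + (norm y)\<^sup>2"
proof -
  have "cinner y x = 0"
    using assms cinner_commute[of y x] by simp
  then have "cinner (x + y) (x + y) = cinner x x + cinner y y"
    using assms by (simp add: cinner_add_left cinner_add_right)
  then show ?thesis
    unfolding cinner_self of_real_add[symmetric] of_real_eq_iff .
qed

text \<open>Cauchy-Schwarz by projection: \<open>c\<close> is chosen so that
  \<open>x - c *\<^sub>C y\<close> is orthogonal to \<open>y\<close>, and Pythagoras then bounds the
  norm of \<open>c *\<^sub>C y\<close> by that of \<open>x\<close>.\<close>

lemma norm_cinner_le: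
  fixes x y :: "'a::chilbert_space"
  shows "cmod (cinner x y) \<le> norm x * norm y"
proof (cases "y = 0")
  case False
  define c where "c = cinner x y / complex_of_real ((norm y)\<^sup>2)"
  have "cinner (x - c *\<^sub>C y) (c *\<^sub>C y) = 0"
    using False by (simp add: cinner_diff_left cinner_scaleC_left cinner_scaleC_right cinner_self c_def)
  from norm_add_orthogonal[OF this]
  have "(norm (c *\<^sub>C y))\<^sup>2 \<le> (norm x)\<^sup>2"
    by simp
  moreover have "(norm (c *\<^sub>C y))\<^sup>2 = (cmod c)\<^sup>2 * (norm y)\<^sup>2"
  proof -
    have "cinner (c *\<^sub>C y) (c *\<^sub>C y) = c * cnj c * cinner y y"
      by (simp only: cinner_scaleC_left cinner_scaleC_right mult_ac)
    then have "cinner (c *\<^sub>C y) (c *\<^sub>C y) = complex_of_real ((cmod c)\<^sup>2 * (norm y)\<^sup>2)"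
      by (simp only: cinner_self complex_norm_square of_real_mult)
    then show ?thesis
      unfolding cinner_self of_real_eq_iff .
  qed
  ultimately have "cmod c * norm y \<le> norm x"
    by (metis norm_ge_zero power2_le_imp_le power_mult_distrib)
  moreover have "cmod c = cmod (cinner x y) / (norm y)\<^sup>2"
    by (simp add: c_def norm_divide norm_power)
  ultimately show ?thesis
    using False by (simp add: field_simps power2_eq_square)
qed simp

lemma tendsto_cinner_left:
  fixes x :: "nat \<Rightarrow> 'a::chilbert_space"
  assumes "x \<longlonglongrightarrow> a"
  shows "(\<lambda>n. cinner (x n) y) \<longlonglongrightarrow> cinner a y"
proof (rule Lim_null[THEN iffD2], rule Lim_null_comparison)
  show "\<forall>\<^sub>F n in sequentially. norm (cinner (x n) y - cinner a y) \<le> norm (x n - a) * norm y"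
    by (intro always_eventually allI) (simp add: norm_cinner_le flip: cinner_diff_left)
  show "(\<lambda>n. norm (x n - a) * norm y) \<longlonglongrightarrow> 0"
    using tendsto_mult_left_zero[OF tendsto_norm_zero[OF Lim_null[THEN iffD1, OF assms]]] .
qed

text \<open>Approximating \<open>x\<close> itself by vectors of \<open>D\<close> gives
  \<open>cinner x x = 0\<close> in the limit. This is what makes the value of an adjoint
  unique.\<close>

lemma orthogonal_dense_eq_0:
  fixes x :: "'a::chilbert_space"
  assumes "closure D = UNIV" and "\<And>v. v \<in> D \<Longrightarrow> cinner v x = 0"
  shows "x = 0"
proof -
  obtain v where v: "\<And>n. v n \<in> D" "v \<longlonglongrightarrow> x"
    using assms(1) closure_sequential[of x D] by auto
  have "(\<lambda>n. 0) \<longlonglongrightarrow> cinner x x"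
    using tendsto_cinner_left[OF v(2), of x] assms(2) v(1) by simp
  then have "cinner x x = 0"
    using LIMSEQ_unique tendsto_const by blast
  then show ?thesis
    by (simp add: cinner_self)
qed

section \<open>Fourier partial sums and Parseval's identity\<close>

definition orthonormal_proj :: "(nat \<Rightarrow> 'a::chilbert_space) \<Rightarrow> nat \<Rightarrow> 'a \<Rightarrow> 'a" where
  "orthonormal_proj u N x = (\<Sum>j=1..N. cinner x (u j) *\<^sub>C u j)"

lemma orthonormal_proj_diff:
  "orthonormal_proj u N (x - y) = orthonormal_proj u N x - orthonormal_proj u N y"
  by (simp add: orthonormal_proj_def cinner_diff_left complex_vector.scale_left_diff_distrib
      sum_subtractf)

context
  fixes u :: "nat \<Rightarrow> 'a::chilbert_space"
  assumes basis: "orthonormal_basis {1..} u"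
begin

lemma cinner_basis: "1 \<le> i \<Longrightarrow> 1 \<le> j \<Longrightarrow> cinner (u i) (u j) = (if i = j then 1 else 0)"
  using basis by (auto simp: orthonormal_basis_def)

lemma cinner_orthonormal_proj:
  assumes "j \<in> {1..N}"
  shows "cinner (orthonormal_proj u N x) (u j) = cinner x (u j)"
proof -
  have "cinner (orthonormal_proj u N x) (u j)
      = (\<Sum>i=1..N. if i = j then cinner x (u i) else 0)"
    unfolding orthonormal_proj_def cinner_sum_left
    by (rule sum.cong) (use assms in \<open>auto simp: cinner_scaleC_left cinner_basis\<close>)
  then show ?thesis
    using assms by simp
qed

text \<open>The remainder is orthogonal to \<open>u 1\<close>, ..., \<open>u N\<close>, hence to the
  partial sum, and Pythagoras applies. The bound is uniform in \<open>N\<close>, so approximation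
  errors stay controlled when \<open>N\<close> grows.\<close>

lemma norm_diff_orthonormal_proj_le: "norm (x - orthonormal_proj u N x) \<le> norm x"
proof -
  have "cinner (x - orthonormal_proj u N x) (orthonormal_proj u N x)
      = (\<Sum>j=1..N. cnj (cinner x (u j)) * cinner (x - orthonormal_proj u N x) (u j))"
    by (subst (2) orthonormal_proj_def) (simp add: cinner_sum_right cinner_scaleC_right)
  also have "\<dots> = 0"
    by (intro sum.neutral) (simp add: cinner_diff_left cinner_orthonormal_proj)
  finally have "(norm (x - orthonormal_proj u N x))\<^sup>2 \<le> (norm x)\<^sup>2"
    by (drule_tac norm_add_orthogonal) simp
  then show ?thesis
    by (rule power2_le_imp_le) simp
qed

text \<open>The vectors that are eventually fixed by the partial sums form a subspace, and each
  \<open>u i\<close> is fixed from \<open>N = i\<close> on.\<close>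

lemma orthonormal_proj_span:
  assumes "y \<in> cspan (u ` {1..})"
  shows "\<exists>M. \<forall>N\<ge>M. orthonormal_proj u N y = y"
proof -
  let ?E = "{y. \<exists>M. \<forall>N\<ge>M. orthonormal_proj u N y = y}"
  have "csubspace ?E"
  proof (rule complex_vector.subspaceI)
    show "0 \<in> ?E"
      by (auto simp: orthonormal_proj_def)
  next
    fix x y assume "x \<in> ?E" "y \<in> ?E"
    then obtain M M' where M: "\<And>N. N \<ge> M \<Longrightarrow> orthonormal_proj u N x = x"
      "\<And>N. N \<ge> M' \<Longrightarrow> orthonormal_proj u N y = y"
      by blast
    have "orthonormal_proj u N (x + y) = x + y" if "N \<ge> max M M'" for N
      using orthonormal_proj_diff[of u N "x + y" y] M(1)[of N] M(2)[of N] that by (simp add: algebra_simps)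
    then show "x + y \<in> ?E"
      by blast
  next
    fix c x assume "x \<in> ?E"
    moreover have "orthonormal_proj u N (c *\<^sub>C x) = c *\<^sub>C orthonormal_proj u N x" for N
      by (simp add: orthonormal_proj_def cinner_scaleC_left complex_vector.scale_sum_right)
    ultimately show "c *\<^sub>C x \<in> ?E"
      by auto
  qed
  moreover have "u ` {1..} \<subseteq> ?E"
  proof safe
    fix i :: nat assume i: "1 \<le> i"
    have "orthonormal_proj u N (u i) = u i" if "N \<ge> i" for N
    proof -
      have "orthonormal_proj u N (u i) = (\<Sum>j=1..N. if j = i then u i else 0)"
        unfolding orthonormal_proj_def by (rule sum.cong) (use i in \<open>auto simp: cinner_basis\<close>)
      then show ?thesis
        using i that by simp
    qed
    then show "\<exists>M. \<forall>N\<ge>M. orthonormal_proj u N (u i) = u i"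
      by blast
  qed
  ultimately show ?thesis
    using complex_vector.span_minimal assms by blast
qed

lemma orthonormal_proj_tendsto: "(\<lambda>N. orthonormal_proj u N x) \<longlonglongrightarrow> x"
proof (rule LIMSEQ_I)
  fix e :: real assume "e > 0"
  moreover have "x \<in> closure (cspan (u ` {1..}))"
    using basis by (simp add: orthonormal_basis_def)
  ultimately obtain y where y: "y \<in> cspan (u ` {1..})" "norm (x - y) < e"
    unfolding closure_approachable by (auto simp: dist_norm norm_minus_commute)
  obtain M where M: "\<And>N. N \<ge> M \<Longrightarrow> orthonormal_proj u N y = y"
    using orthonormal_proj_span[OF y(1)] by blast
  have "norm (orthonormal_proj u N x - x) < e" if "N \<ge> M" for N
    \<comment> \<open>Since the partial sum fixes \<open>y\<close>, the remainder of
      \<open>x\<close> equals the remainder of \<open>x - y\<close>, whose norm is less than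
      \<open>e\<close>.\<close>
    using norm_diff_orthonormal_proj_le[of "x - y" N] y(2) M[OF that]
    by (simp add: orthonormal_proj_diff norm_minus_commute)
  then show "\<exists>M. \<forall>N\<ge>M. norm (orthonormal_proj u N x - x) < e"
    by blast
qed

text \<open>The partial sums are scalar products of \<open>orthonormal_proj u N x\<close> with
  \<open>y\<close>. The limit form is chosen because the main estimate is proved for finite
  \<open>N\<close> first.\<close>

lemma parseval:
  "(\<lambda>N. \<Sum>j=1..N. cinner x (u j) * cnj (cinner y (u j))) \<longlonglongrightarrow> cinner x y"
proof -
  have "cinner (orthonormal_proj u N x) y = (\<Sum>j=1..N. cinner x (u j) * cnj (cinner y (u j)))" for N
    unfolding orthonormal_proj_def cinner_sum_left cinner_scaleC_left
    by (simp add: cinner_commute[of _ y])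
  then show ?thesis
    using tendsto_cinner_left[OF orthonormal_proj_tendsto, of x y] by simp
qed

end

section \<open>Self-adjoint operators and commutators on eigenvectors\<close>

lemma self_adjoint_cinner:
  assumes "self_adjoint D A" "v \<in> D" "w \<in> D"
  shows "cinner (A v) w = cinner v (A w)"
proof -
  have D: "closure D = UNIV" and w: "w \<in> adjoint_domain D A" and Aw: "adjoint_operator D A w = A w"
    using assms by (auto simp: self_adjoint_def)
  obtain z where z: "\<forall>v\<in>D. cinner (A v) w = cinner v z"
    using w by (auto simp: adjoint_domain_def)
  \<comment> \<open>The adjoint is a definite description, so its value is known only after
    uniqueness, which comes from the density of \<open>D\<close>.\<close>
  have "z' = z" if "\<forall>v\<in>D. cinner (A v) w = cinner v z'" for z'
    using orthogonal_dense_eq_0[OF D, of "z' - z"] that z by (simp add: cinner_diff_right)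
  then have "adjoint_operator D A w = z"
    unfolding adjoint_operator_def by (intro the_equality z)
  then show ?thesis
    using Aw z assms(2) by simp
qed

lemma commutator_eigenvector:
  assumes "linear_operator E B" "D \<subseteq> E" "w \<in> eigenspace D A z"
  shows "commutator A B w = A (B w) - z *\<^sub>C B w"
  using assms by (auto simp: commutator_def linear_operator_def eigenspace_def)

text \<open>Because \<open>B v\<close> stays in \<open>D\<close>, the operator \<open>A\<close> can
  be moved onto \<open>w\<close>, where it acts as \<open>b\<close>; the other term of the
  commutator contributes \<open>a\<close>.\<close>

lemma cinner_commutator_eigenvector:
  assumes "self_adjoint D A" "linear_operator E B" "D \<subseteq> E" "B ` D \<subseteq> D"
    and v: "v \<in> eigenspace D A (complex_of_real a)" and w: "w \<in> eigenspace D A (complex_of_real b)"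
  shows "cinner (commutator A B v) w = complex_of_real (b - a) * cinner (B v) w"
proof -
  have "v \<in> D" "w \<in> D" and Aw: "A w = complex_of_real b *\<^sub>C w"
    using v w by (auto simp: eigenspace_def)
  then have "cinner (A (B v)) w = cinner (B v) (A w)"
    using assms(4) self_adjoint_cinner[OF assms(1)] by blast
  then show ?thesis
    by (simp add: commutator_eigenvector[OF assms(2,3) v] Aw cinner_diff_left cinner_scaleC_left
        cinner_scaleC_right algebra_simps)
qed

section \<open>The inequality for finite sums\<close>

text \<open>Termwise \<open>x i\<close> is bounded in absolute value by the product of the square
  roots of \<open>y i\<close> and \<open>z i\<close>, to which Cauchy-Schwarz applies.\<close>

lemma cauchy_schwarz_sum_le:
  fixes x y z :: "'i \<Rightarrow> real"
  assumes "\<And>i. i \<in> I \<Longrightarrow> 0 \<le> y i" "\<And>i. i \<in> I \<Longrightarrow> 0 \<le> z i" "\<And>i. i \<in> I \<Longrightarrow> (x i)\<^sup>2 \<le> y i * z i"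
  shows "(\<Sum>i\<in>I. x i)\<^sup>2 \<le> (\<Sum>i\<in>I. y i) * (\<Sum>i\<in>I. z i)"
proof -
  have "\<bar>x i\<bar> \<le> sqrt (y i) * sqrt (z i)" if "i \<in> I" for i
    using real_sqrt_le_mono[OF assms(3)[OF that]] by (simp add: real_sqrt_mult)
  then have "\<bar>\<Sum>i\<in>I. x i\<bar> \<le> (\<Sum>i\<in>I. sqrt (y i) * sqrt (z i))"
    by (rule order_trans[OF sum_abs sum_mono])
  then have "(\<Sum>i\<in>I. x i)\<^sup>2 \<le> (\<Sum>i\<in>I. sqrt (y i) * sqrt (z i))\<^sup>2"
    by (metis abs_ge_zero power2_abs power_mono)
  also have "\<dots> \<le> (\<Sum>i\<in>I. (sqrt (y i))\<^sup>2) * (\<Sum>i\<in>I. (sqrt (z i))\<^sup>2)"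
    by (rule Cauchy_Schwarz_ineq_sum)
  finally show ?thesis
    using assms(1,2) by simp
qed

text \<open>Only the square block of indices up to \<open>k\<close> is stable under exchanging
  \<open>i\<close> and \<open>j\<close>; there each term is replaced by its mean with the transposed
  term, while the columns beyond \<open>k\<close> are kept.\<close>

lemma sum_symmetrise:
  fixes t :: "nat \<Rightarrow> nat \<Rightarrow> real"
  assumes "k \<le> N"
  shows "(\<Sum>i=1..k. \<Sum>j=1..N. t i j)
    = (\<Sum>(i, j)\<in>{1..k} \<times> {1..N}. if j \<le> k then (t i j + t j i) / 2 else t i j)"
proof -
  have split: "(\<Sum>j=1..N. s j) = (\<Sum>j=1..k. s j) + (\<Sum>j=k+1..N. s j)" for s :: "nat \<Rightarrow> real"
    using sum.ub_add_nat[of 1 k s "N - k"] assms by simp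
  have "(\<Sum>i=1..k. \<Sum>j=1..k. t i j) = (\<Sum>i=1..k. \<Sum>j=1..k. (t i j + t j i) / 2)"
    using sum.swap[of t "{1..k}" "{1..k}"]
    by (simp add: sum.distrib sum_divide_distrib[symmetric])
  then show ?thesis
    unfolding sum.cartesian_product[symmetric] split sum.distrib by simp
qed

text \<open>Here \<open>a\<close> stands for the eigenvalues and \<open>c i j\<close> for the
  squared Fourier coefficients, summed over the operators. Symmetrising first is essential: before
  it, the terms with \<open>g\<close> may be negative when \<open>a j < a i\<close>.\<close>

lemma truncated_inequality:
  fixes a f g h :: "nat \<Rightarrow> real" and c :: "nat \<Rightarrow> nat \<Rightarrow> real"
  assumes "k \<le> N"
    and c: "\<And>i j. 0 \<le> c i j" "\<And>i j. i \<in> {1..k} \<Longrightarrow> j \<in> {1..k} \<Longrightarrow> c i j = c j i"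
    and nonneg: "\<And>i. i \<in> {1..k} \<Longrightarrow> 0 \<le> g i" "\<And>i. i \<in> {1..k} \<Longrightarrow> 0 \<le> h i"
    and inner: "\<And>i j. i \<in> {1..k} \<Longrightarrow> j \<in> {1..k} \<Longrightarrow> 0 \<le> (g i - g j) * (a j - a i)"
      "\<And>i j. i \<in> {1..k} \<Longrightarrow> j \<in> {1..k} \<Longrightarrow>
        (f i - f j)\<^sup>2 \<le> (g i - g j) * (a j - a i) * (h i + h j)"
    and outer: "\<And>i j. i \<in> {1..k} \<Longrightarrow> k < j \<Longrightarrow> a i \<le> a j"
      "\<And>i j. i \<in> {1..k} \<Longrightarrow> k < j \<Longrightarrow> (f i)\<^sup>2 \<le> g i * h i * (a j - a i)"
  shows "(\<Sum>i=1..k. \<Sum>j=1..N. f i * ((a j - a i) * c i j))\<^sup>2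
    \<le> (\<Sum>i=1..k. \<Sum>j=1..N. g i * ((a j - a i) * c i j))
      * (\<Sum>i=1..k. \<Sum>j=1..N. h i * ((a j - a i)\<^sup>2 * c i j))"
proof -
  define x where "x i j = (if j \<le> k then (f i * ((a j - a i) * c i j) + f j * ((a i - a j) * c j i)) / 2
    else f i * ((a j - a i) * c i j))" for i j
  define y where "y i j = (if j \<le> k then (g i * ((a j - a i) * c i j) + g j * ((a i - a j) * c j i)) / 2
    else g i * ((a j - a i) * c i j))" for i j
  define z where "z i j = (if j \<le> k then (h i * ((a j - a i)\<^sup>2 * c i j) + h j * ((a i - a j)\<^sup>2 * c j i)) / 2
    else h i * ((a j - a i)\<^sup>2 * c i j))" for i j
  have key: "0 \<le> y i j \<and> 0 \<le> z i j \<and> (x i j)\<^sup>2 \<le> y i j * z i j"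
    if ij: "i \<in> {1..k}" "j \<in> {1..N}" for i j
  proof (cases "j \<le> k")
    case True
    then have j: "j \<in> {1..k}"
      using ij by simp
    \<comment> \<open>Exchanging \<open>i\<close> and \<open>j\<close> flips the sign of
      \<open>a j - a i\<close> but not of its square: this leaves differences of \<open>f\<close>
      and of \<open>g\<close>, but a sum of \<open>h\<close>.\<close>
    have x_eq: "x i j = (f i - f j) * ((a j - a i) * c i j / 2)"
      and y_eq: "y i j = ((g i - g j) * (a j - a i)) * (c i j / 2)"
      and z_eq: "z i j = (h i + h j) * ((a j - a i)\<^sup>2 * (c i j / 2))"
      using True c(2)[OF ij(1) j]
      by (simp_all add: x_def y_def z_def field_simps power2_eq_square)
    have "(x i j)\<^sup>2 = (f i - f j)\<^sup>2 * ((a j - a i) * c i j / 2)\<^sup>2"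
      unfolding x_eq by (rule power_mult_distrib)
    also have "\<dots> \<le> ((g i - g j) * (a j - a i) * (h i + h j)) * ((a j - a i) * c i j / 2)\<^sup>2"
      by (rule mult_right_mono[OF inner(2)[OF ij(1) j]]) simp
    also have "\<dots> = y i j * z i j"
      unfolding y_eq z_eq by (simp add: power2_eq_square)
    finally have "(x i j)\<^sup>2 \<le> y i j * z i j" .
    moreover have "0 \<le> y i j"
      unfolding y_eq by (intro mult_nonneg_nonneg[OF inner(1)[OF ij(1) j]]) (simp add: c)
    moreover have "0 \<le> z i j"
      unfolding z_eq using nonneg(2)[OF ij(1)] nonneg(2)[OF j] by (simp add: c)
    ultimately show ?thesis
      by blast
  next
    case False
    then have j: "k < j"
      by simp
    have "(f i * ((a j - a i) * c i j))\<^sup>2 = (f i)\<^sup>2 * ((a j - a i) * c i j)\<^sup>2"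
      by (rule power_mult_distrib)
    also have "\<dots> \<le> (g i * h i * (a j - a i)) * ((a j - a i) * c i j)\<^sup>2"
      by (rule mult_right_mono[OF outer(2)[OF ij(1) j]]) simp
    also have "\<dots> = (g i * ((a j - a i) * c i j)) * (h i * ((a j - a i)\<^sup>2 * c i j))"
      by (simp add: power2_eq_square)
    finally show ?thesis
      using False nonneg[OF ij(1)] outer(1)[OF ij(1) j] by (simp add: x_def y_def z_def c)
  qed
  have "(\<Sum>(i, j)\<in>{1..k} \<times> {1..N}. x i j)\<^sup>2
      \<le> (\<Sum>(i, j)\<in>{1..k} \<times> {1..N}. y i j) * (\<Sum>(i, j)\<in>{1..k} \<times> {1..N}. z i j)"
    by (rule cauchy_schwarz_sum_le) (use key in auto)
  then show ?thesis
    unfolding sum_symmetrise[OF assms(1)] x_def y_def z_def .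
qed

text \<open>The order on the complex numbers also demands equal imaginary parts. Limits of real
  sequences are real, so the comparison reduces to real parts.\<close>

lemma tendsto_of_real_square_le_mult:
  fixes X Y Z :: complex
  assumes "(\<lambda>n. complex_of_real (x n)) \<longlonglongrightarrow> X" "(\<lambda>n. complex_of_real (y n)) \<longlonglongrightarrow> Y"
    "(\<lambda>n. complex_of_real (z n)) \<longlonglongrightarrow> Z"
    and le: "\<forall>\<^sub>F n in sequentially. (x n)\<^sup>2 \<le> y n * z n"
  shows "X\<^sup>2 \<le> Y * Z"
proof -
  have lim: "t \<longlonglongrightarrow> Re T" "complex_of_real (Re T) = T"
    if "(\<lambda>n. complex_of_real (t n)) \<longlonglongrightarrow> T" for t T
  proof -
    show t: "t \<longlonglongrightarrow> Re T"
      using tendsto_Re[OF that] by simp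
    show "complex_of_real (Re T) = T"
      using LIMSEQ_unique[OF tendsto_of_real[OF t] that] .
  qed
  have "(Re X)\<^sup>2 \<le> Re Y * Re Z"
    using tendsto_le[OF sequentially_bot tendsto_mult[OF lim(1)[OF assms(2)] lim(1)[OF assms(3)]]
        tendsto_power[OF lim(1)[OF assms(1)]] le] .
  then have "complex_of_real ((Re X)\<^sup>2) \<le> complex_of_real (Re Y * Re Z)"
    by (simp add: less_eq_complex_def)
  then show ?thesis
    by (simp only: of_real_power of_real_mult lim(2)[OF assms(1)] lim(2)[OF assms(2)]
        lim(2)[OF assms(3)])
qed

section \<open>The commutator inequality\<close>

(* The inequality is between complex numbers: by the order of HOL-Library.Complex_Order it
   says that both sides have the same imaginary part (here 0) and compares the real parts. *)
theorem corollary2p1: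
  fixes A :: "'a::chilbert_space \<Rightarrow> 'a" and D :: "'a set"
    and B :: "nat \<Rightarrow> 'a \<Rightarrow> 'a" and dom_B :: "nat \<Rightarrow> 'a set"
    and ev :: "nat \<Rightarrow> real" and u :: "nat \<Rightarrow> 'a"
    and f g :: "real \<Rightarrow> real" and S :: "real set" and k n :: nat
  assumes "self_adjoint D A"
    and "semibounded_below D A"
    and "discrete_spectrum D A"
    and "lists_spectrum D A ev"
    and "\<And>p. p \<in> {1..n} \<Longrightarrow> symmetric_operator (dom_B p) (B p)"
    and "\<And>p. p \<in> {1..n} \<Longrightarrow> D \<union> A ` D \<subseteq> dom_B p"
    and "\<And>p. p \<in> {1..n} \<Longrightarrow> B p ` D \<subseteq> D"
    and "orthonormal_basis {1..} u"
    and "\<And>i. 1 \<le> i \<Longrightarrow> u i \<in> eigenspace D A (complex_of_real (ev i))"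
    and "1 \<le> k"
    and "ev k < ev (k + 1)"
    and "ev ` {1..k} \<subseteq> S"
    and "(f, g) \<in> Im_couples S (ev (k + 1))"
  shows "(\<Sum>i=1..k. \<Sum>p=1..n. complex_of_real (f (ev i)) *
            cinner (commutator A (B p) (u i)) (B p (u i)))\<^sup>2
       \<le> (\<Sum>i=1..k. \<Sum>p=1..n. complex_of_real (g (ev i)) *
            cinner (commutator A (B p) (u i)) (B p (u i)))
         * (\<Sum>i=1..k. \<Sum>p=1..n. complex_of_real
              ((f (ev i))\<^sup>2 / (g (ev i) * (ev (k + 1) - ev i)) *
               (norm (commutator A (B p) (u i)))\<^sup>2))"
proof -
  define b where "b p i j = (cmod (cinner (B p (u i)) (u j)))\<^sup>2" for p i j
  define c where "c i j = (\<Sum>p=1..n. b p i j)" for i j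
  define h where "h i = (f (ev i))\<^sup>2 / (g (ev i) * (ev (k + 1) - ev i))" for i

  \<comment> \<open>What the ordering of the eigenvalues and condition (2) give\<close>
  have mono: "ev i \<le> ev j" if "1 \<le> i" "i \<le> j" for i j
    using that(2,1)
  proof (induction j rule: dec_induct)
    case (step m)
    then show ?case
      using assms(4) order_trans[of "ev i" "ev m" "ev (Suc m)"] by (auto simp: lists_spectrum_def)
  qed simp
  have less: "ev i < ev (k + 1)" if "i \<in> {1..k}" for i
    using mono[of i k] that assms(11) by auto
  have in_S: "ev i \<in> S" if "i \<in> {1..k}" for i
    using assms(12) that by blast
  have pos: "0 < f (ev i)" "0 < g (ev i)" if "i \<in> {1..k}" for i
    using assms(13) in_S[OF that] by (simp_all add: Im_couples_def)
  have h_pos: "0 < h i" if "i \<in> {1..k}" for i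
    using pos[OF that] less[OF that] by (simp add: h_def)
  \<comment> \<open>This is condition (2) multiplied by \<open>(ev i - ev j)\<^sup>2\<close>. In
    this form it also covers repeated eigenvalues, where both sides vanish.\<close>
  have couple: "(f (ev i) - f (ev j))\<^sup>2 \<le> (g (ev i) - g (ev j)) * (ev j - ev i) * (h i + h j)"
    if "i \<in> {1..k}" "j \<in> {1..k}" for i j
  proof (cases "ev i = ev j")
    case False
    let ?d = "ev i - ev j"
    have "((f (ev i) - f (ev j)) / ?d)\<^sup>2 + (h i + h j) * ((g (ev i) - g (ev j)) / ?d) \<le> 0"
      using assms(13) False in_S[OF that(1)] in_S[OF that(2)]
      unfolding Im_couples_def h_def mem_Collect_eq prod.case by blast
    then have "?d\<^sup>2 * (((f (ev i) - f (ev j)) / ?d)\<^sup>2 + (h i + h j) * ((g (ev i) - g (ev j)) / ?d)) \<le> 0"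
      by (rule mult_nonneg_nonpos[OF zero_le_power2])
    also have "?d\<^sup>2 * (((f (ev i) - f (ev j)) / ?d)\<^sup>2 + (h i + h j) * ((g (ev i) - g (ev j)) / ?d))
      = (f (ev i) - f (ev j))\<^sup>2 + (h i + h j) * ((g (ev i) - g (ev j)) * ?d)"
      using False by (simp add: power_divide distrib_left) (simp add: power2_eq_square)
    finally show ?thesis
      by (simp add: algebra_simps)
  qed simp
  \<comment> \<open>The right-hand side of \<open>couple\<close> dominates a square, and its factor
    \<open>h i + h j\<close> is positive.\<close>
  have g_antitone: "0 \<le> (g (ev i) - g (ev j)) * (ev j - ev i)"
    if "i \<in> {1..k}" "j \<in> {1..k}" for i j
  proof -
    have "0 \<le> (g (ev i) - g (ev j)) * (ev j - ev i) * (h i + h j)"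
      using couple[OF that] zero_le_power2 order_trans by blast
    then show ?thesis
      using h_pos[OF that(1)] h_pos[OF that(2)] by (simp add: zero_le_mult_iff)
  qed
  have outer: "(f (ev i))\<^sup>2 \<le> g (ev i) * h i * (ev j - ev i)" if "i \<in> {1..k}" "k < j" for i j
  proof -
    \<comment> \<open>The weight \<open>h\<close> is exactly the one giving equality at
      \<open>ev (k + 1)\<close>; larger eigenvalues only increase the right-hand side.\<close>
    have "(f (ev i))\<^sup>2 = g (ev i) * h i * (ev (k + 1) - ev i)"
      using pos[OF that(1)] less[OF that(1)] by (simp add: h_def)
    also have "\<dots> \<le> g (ev i) * h i * (ev j - ev i)"
      using mono[of "k + 1" j] that pos[OF that(1)] h_pos[OF that(1)]
      by (intro mult_left_mono) auto
    finally show ?thesis .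
  qed

  \<comment> \<open>Fourier coefficients of \<open>B p (u i)\<close> and of the commutators\<close>
  have u_D: "u i \<in> D" if "1 \<le> i" for i
    using assms(9)[OF that] by (simp add: eigenspace_def)
  have b_sym: "b p i j = b p j i" if "p \<in> {1..n}" "i \<in> {1..k}" "j \<in> {1..k}" for p i j
  proof -
    have "cinner (B p (u i)) (u j) = cinner (u i) (B p (u j))"
      using assms(5,6)[OF that(1)] u_D[of i] u_D[of j] that(2,3)
      by (auto simp: symmetric_operator_def subset_iff)
    then show ?thesis
      unfolding b_def by (metis cinner_commute complex_mod_cnj)
  qed
  have coeff: "cinner (commutator A (B p) (u i)) (u j)
      = complex_of_real (ev j - ev i) * cinner (B p (u i)) (u j)"
    if "p \<in> {1..n}" "1 \<le> i" "1 \<le> j" for p i j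
    using assms(5,6,7)[OF that(1)] assms(9)[OF that(2)] assms(9)[OF that(3)]
    by (intro cinner_commutator_eigenvector[OF assms(1)]) (auto simp: symmetric_operator_def)
  have lim1: "(\<lambda>N. complex_of_real (\<Sum>j=1..N. (ev j - ev i) * b p i j))
      \<longlonglongrightarrow> cinner (commutator A (B p) (u i)) (B p (u i))"
    if "p \<in> {1..n}" "i \<in> {1..k}" for p i
  proof -
    have "complex_of_real (\<Sum>j=1..N. (ev j - ev i) * b p i j)
      = (\<Sum>j=1..N. cinner (commutator A (B p) (u i)) (u j) * cnj (cinner (B p (u i)) (u j)))" for N
      unfolding of_real_sum
      by (rule sum.cong) (use that in \<open>auto simp: coeff b_def complex_norm_square simp del: of_real_power\<close>)
    then show ?thesis
      using parseval[OF assms(8)] by simp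
  qed
  have lim2: "(\<lambda>N. complex_of_real (\<Sum>j=1..N. (ev j - ev i)\<^sup>2 * b p i j))
      \<longlonglongrightarrow> complex_of_real ((norm (commutator A (B p) (u i)))\<^sup>2)"
    if "p \<in> {1..n}" "i \<in> {1..k}" for p i
  proof -
    have "complex_of_real (\<Sum>j=1..N. (ev j - ev i)\<^sup>2 * b p i j)
      = (\<Sum>j=1..N. cinner (commutator A (B p) (u i)) (u j)
          * cnj (cinner (commutator A (B p) (u i)) (u j)))" for N
      unfolding of_real_sum
    proof (rule sum.cong[OF refl])
      fix j assume "j \<in> {1..N}"
      then have "(ev j - ev i)\<^sup>2 * b p i j = (cmod (cinner (commutator A (B p) (u i)) (u j)))\<^sup>2"
        using that by (simp add: coeff b_def norm_mult power_mult_distrib flip: of_real_diff)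
      then show "complex_of_real ((ev j - ev i)\<^sup>2 * b p i j)
        = cinner (commutator A (B p) (u i)) (u j) * cnj (cinner (commutator A (B p) (u i)) (u j))"
        by (simp only: complex_norm_square)
    qed
    then show ?thesis
      using parseval[OF assms(8)] unfolding cinner_self[symmetric] by simp
  qed

  \<comment> \<open>Truncated sums and passage to the limit\<close>
  have swap: "(\<Sum>i=1..k. \<Sum>j=1..N. r i * (s i j * c i j))
      = (\<Sum>i=1..k. \<Sum>p=1..n. r i * (\<Sum>j=1..N. s i j * b p i j))" for r :: "nat \<Rightarrow> real" and s N
    unfolding c_def sum_distrib_left by (rule sum.cong[OF refl], rule sum.swap)
  \<comment> \<open>The coefficient \<open>r\<close> is left free so that one limit statement serves
    both \<open>f\<close> and \<open>g\<close>.\<close>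
  define X where "X r N = (\<Sum>i=1..k. \<Sum>j=1..N. r i * ((ev j - ev i) * c i j))" for r N
  define Z where "Z N = (\<Sum>i=1..k. \<Sum>j=1..N. h i * ((ev j - ev i)\<^sup>2 * c i j))" for N
  have limX: "(\<lambda>N. complex_of_real (X r N)) \<longlonglongrightarrow> (\<Sum>i=1..k. \<Sum>p=1..n. complex_of_real (r i) *
      cinner (commutator A (B p) (u i)) (B p (u i)))" for r
    unfolding X_def swap of_real_sum[of _ "{1..k}"] of_real_sum[of _ "{1..n}"] of_real_mult[of "r _"]
    by (intro tendsto_sum tendsto_mult_left lim1)
  have limZ: "(\<lambda>N. complex_of_real (Z N)) \<longlonglongrightarrow> (\<Sum>i=1..k. \<Sum>p=1..n. complex_of_real
      (h i * (norm (commutator A (B p) (u i)))\<^sup>2))"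
    unfolding Z_def swap of_real_sum[of _ "{1..k}"] of_real_sum[of _ "{1..n}"] of_real_mult[of "h _"]
    by (intro tendsto_sum tendsto_mult_left lim2)
  \<comment> \<open>The truncation must contain the whole block of indices up to \<open>k\<close> to
    be symmetrised, hence \<open>k \<le> N\<close>; this holds eventually, which suffices for the
    limit.\<close>
  have "(X (\<lambda>i. f (ev i)) N)\<^sup>2 \<le> X (\<lambda>i. g (ev i)) N * Z N" if "k \<le> N" for N
    unfolding X_def Z_def
  proof (rule truncated_inequality[OF that])
    show "0 \<le> c i j" for i j
      by (simp add: c_def b_def sum_nonneg)
    show "c i j = c j i" if "i \<in> {1..k}" "j \<in> {1..k}" for i j
      using b_sym that by (simp add: c_def)
    show "ev i \<le> ev j" if "i \<in> {1..k}" "k < j" for i j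
      using mono[of i j] that by simp
  qed (fact pos(2)[THEN less_imp_le] h_pos[THEN less_imp_le] g_antitone couple outer)+
  then have "\<forall>\<^sub>F N in sequentially. (X (\<lambda>i. f (ev i)) N)\<^sup>2 \<le> X (\<lambda>i. g (ev i)) N * Z N"
    by (auto simp: eventually_sequentially)
  from tendsto_of_real_square_le_mult[OF limX limX limZ this]
  show ?thesis
    unfolding h_def .
qed

end
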